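(* Let $B$ be any set of permutations and let $\mathcal{C}=\operatorname{Av}(B)$. Then the set of permutations that can be generated by the $\mathcal{C}$-machine is exactly the permutation class \[ \operatorname{Av}(1\ominus B)=\operatorname{Av}(\{1\ominus\beta\::\:\beta\in B\}). \]
   Context: A permutation $\pi$ contains $\sigma$ if $\pi$ has a subsequence order isomorphic to $\sigma$; otherwise $\pi$ avoids $\sigma$. For a set $B$ of permutations, $\operatorname{Av}(B)$ is the set of permutations avoiding every element of $B$. A permutation class is a set of permutations closed downward under containment. For a permutation $\beta$ of length $\ell$, the skew sum $1\ominus\beta$ is the permutation of length $\ell+1$ given by $(1\ominus\beta)(1)=\ell+1$ and $(1\ominus\beta)(i)=\beta(i-1)$ for $2\le i\le \ell+1$. For a permutation class $\mathcal{C}$, the $\mathcal{C}$-machine is defined as follows. It has an input, initially $1,2,\dots,n$, a container, initially empty, holding a sequence of distinct integers, and an output, initially empty. At any time one may perform one of three operations: (bypass) remove the next entry of the input and append it to the end of the output; (push) remove the next entry of the input and insert it at any position of the container, provided the resulting sequence in the container is order isomorphic to a permutation in $\mathcal{C}$; (pop) remove the leftmost entry of the container and append it to the end of the output. A permutation $\pi$ of length $n$ can be generated by the $\mathcal{C}$-machine if some sequence of these operations, starting from input $1,2,\dots,n$, ends with empty input and empty container and with output equal to $\pi$ (read left to right).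
   Formalization: The set B is assumed not to contain the empty permutation; if it did, Av(B) would be empty while bypasses still generate every identity permutation, whereas Av(1⊖B) would contain at most the empty permutation, so the claim would fail. *)

theory Defs
  imports "HOL-Library.Sublist" "HOL-Combinatorics.Multiset_Permutations"
begin

text \<open>Permutations are in one-line notation; the empty permutation is included.\<close>

definition perms :: "nat list set" where
  "perms = (\<Union>n. permutations_of_set {1..n})"

definition order_iso :: "nat list \<Rightarrow> nat list \<Rightarrow> bool" where
  "order_iso xs ys \<longleftrightarrow> length xs = length ys \<and>
     (\<forall>i<length xs. \<forall>j<length xs. xs ! i < xs ! j \<longleftrightarrow> ys ! i < ys ! j)"

definition contains :: "nat list \<Rightarrow> nat list \<Rightarrow> bool" where
  "contains \<pi> \<sigma> \<longleftrightarrow> (\<exists>xs. subseq xs \<pi> \<and> order_iso xs \<sigma>)"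

definition Av :: "nat list set \<Rightarrow> nat list set" where
  "Av B = {\<pi> \<in> perms. \<forall>\<sigma>\<in>B. \<not> contains \<pi> \<sigma>}"

definition perm_class :: "nat list set \<Rightarrow> bool" where
  "perm_class C \<longleftrightarrow> C \<subseteq> perms \<and> (\<forall>\<pi>\<in>C. \<forall>\<sigma>\<in>perms. contains \<pi> \<sigma> \<longrightarrow> \<sigma> \<in> C)"

definition one_skew :: "nat list \<Rightarrow> nat list" where
  "one_skew \<beta> = Suc (length \<beta>) # \<beta>"

text \<open>A state is a triple (input, container, output).\<close>

inductive machine_step ::
  "nat list set \<Rightarrow> nat list \<times> nat list \<times> nat list \<Rightarrow> nat list \<times> nat list \<times> nat list \<Rightarrow> bool"
  for C :: "nat list set" where
  bypass: "machine_step C (a # inp, c, out) (inp, c, out @ [a])"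
| push: "\<exists>\<sigma>\<in>C. order_iso (xs @ a # ys) \<sigma> \<Longrightarrow>
    machine_step C (a # inp, xs @ ys, out) (inp, xs @ a # ys, out)"
| pop: "machine_step C (inp, a # c, out) (inp, c, out @ [a])"

definition generated :: "nat list set \<Rightarrow> nat list set" where
  "generated C = {\<pi> \<in> perms.
     (machine_step C)\<^sup>*\<^sup>* ([1..<Suc (length \<pi>)], [], []) ([], [], \<pi>)}"

end

theory Submission
  imports Defs
begin

text \<open>
  The entries of the container leave it in their left-to-right order, so the container is always
  a subsequence of what remains to be output. At the moment an entry \<open>a\<close> is output, the smaller
  entries still to be output all lie in the container, in their final order. Hence if \<open>a\<close> were the
  leading maximum of a copy of \<open>1 \<ominus> \<beta>\<close> in the output, the container would hold a copy of \<open>\<beta>\<close>.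
  Conversely, an avoider is generated greedily: the next entry of the input is pushed, at the
  position dictated by the desired output, only while the next output entry \<open>a\<close> is still further
  behind in the input. The container then consists of entries smaller than \<open>a\<close> that follow \<open>a\<close> in
  the output, so it contains no \<open>\<beta>\<close>.
\<close>

section \<open>Order isomorphism as relabelling, and its effect on containment\<close>

lemma subseq_set_subset: "subseq xs ys \<Longrightarrow> set xs \<subseteq> set ys"
  by (auto elim: list_emb_set)

lemma order_iso_map_strict_mono:
  assumes "strict_mono_on (set xs) f"
  shows "order_iso xs (map f xs)"
  using assms unfolding order_iso_def
  by (auto simp: strict_mono_on_less)

text \<open>A relabelling of values, unlike a matching of positions, restricts at once to
  subsequences; this is how copies of a pattern are transported.\<close>

lemma order_iso_obtain_map:
  assumes "order_iso xs ys"
  obtains f where "ys = map f xs" "strict_mono_on (set xs) f"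
proof -
  have len: "length ys = length xs"
    and iso: "\<And>i j. i < length xs \<Longrightarrow> j < length xs \<Longrightarrow> xs ! i < xs ! j \<longleftrightarrow> ys ! i < ys ! j"
    using assms by (auto simp: order_iso_def)
  define f where "f x = ys ! (SOME i. i < length xs \<and> xs ! i = x)" for x
  have f_nth: "f (xs ! i) = ys ! i" if "i < length xs" for i
  proof -
    define k where "k = (SOME k. k < length xs \<and> xs ! k = xs ! i)"
    have k: "k < length xs \<and> xs ! k = xs ! i"
      unfolding k_def by (rule someI[of _ i]) (use that in simp)
    \<comment> \<open>Entries may repeat, so \<open>k\<close> can differ from \<open>i\<close>;
      equal entries of \<open>xs\<close> are incomparable under \<open><\<close>, which forces
      equality in \<open>ys\<close> as well.\<close>
    then have "ys ! k = ys ! i"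
      using iso[of k i] iso[of i k] that by auto
    then show ?thesis
      by (simp add: f_def k_def)
  qed
  show thesis
  proof
    show "ys = map f xs"
      by (rule nth_equalityI) (simp_all add: len f_nth)
    show "strict_mono_on (set xs) f"
      by (rule strict_mono_onI) (auto simp: in_set_conv_nth f_nth iso)
  qed
qed

lemma order_iso_sym: "order_iso xs ys \<Longrightarrow> order_iso ys xs"
  by (auto simp: order_iso_def)

lemma order_iso_trans: "order_iso xs ys \<Longrightarrow> order_iso ys zs \<Longrightarrow> order_iso xs zs"
  by (auto simp: order_iso_def)

lemma contains_subseq: "contains xs \<beta> \<Longrightarrow> subseq xs ys \<Longrightarrow> contains ys \<beta>"
  unfolding contains_def using subseq_order.order_trans by blast

lemma contains_order_iso:
  assumes "contains xs \<beta>" "order_iso xs ys"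
  shows "contains ys \<beta>"
proof -
  obtain zs where zs: "subseq zs xs" "order_iso zs \<beta>"
    using assms(1) by (auto simp: contains_def)
  obtain f where f: "ys = map f xs" "strict_mono_on (set xs) f"
    using assms(2) by (rule order_iso_obtain_map)
  have "strict_mono_on (set zs) f"
    using f(2) zs(1) by (meson monotone_on_subset subseq_set_subset)
  then have "order_iso (map f zs) \<beta>"
    using zs(2) order_iso_map_strict_mono order_iso_sym order_iso_trans by blast
  moreover have "subseq (map f zs) ys"
    using zs(1) f(1) by (simp add: subseq_map)
  ultimately show ?thesis
    by (auto simp: contains_def)
qed

lemma contains_trans: "contains \<pi> \<sigma> \<Longrightarrow> contains \<sigma> \<tau> \<Longrightarrow> contains \<pi> \<tau>"
  by (meson contains_def contains_order_iso contains_subseq order_iso_sym)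

lemma perm_class_Av: "perm_class (Av B)"
  unfolding perm_class_def Av_def using contains_trans by blast

section \<open>Standardization of lists with distinct entries\<close>

text \<open>Each entry is replaced by its rank. Ranks increase strictly with the entries and lie
  between 1 and \<open>length xs\<close>, so by counting they fill that interval.\<close>

lemma ex_perm_order_iso:
  assumes "distinct xs"
  obtains \<sigma> where "\<sigma> \<in> perms" "order_iso xs \<sigma>"
proof
  let ?rank = "\<lambda>x. card {y \<in> set xs. y \<le> x}"
  have mono: "strict_mono_on (set xs) ?rank"
  proof (rule strict_mono_onI, rule psubset_card_mono)
    fix x y assume "x \<in> set xs" "y \<in> set xs" "x < y"
    then have "y \<in> {z \<in> set xs. z \<le> y} - {z \<in> set xs. z \<le> x}"
      by simp
    then show "{z \<in> set xs. z \<le> x} \<subset> {z \<in> set xs. z \<le> y}"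
      using \<open>x < y\<close> by (intro psubsetI) (blast | force)+
  qed simp
  then show "order_iso xs (map ?rank xs)"
    by (rule order_iso_map_strict_mono)
  have inj: "inj_on ?rank (set xs)"
    using mono by (rule strict_mono_on_imp_inj_on)
  have "?rank x \<in> {1..length xs}" if "x \<in> set xs" for x
  proof -
    have "?rank x \<le> card (set xs)"
      by (rule card_mono) auto
    moreover have "?rank x > 0"
      using that by (auto simp: card_gt_0_iff)
    ultimately show ?thesis
      using assms by (simp add: distinct_card)
  qed
  then have "?rank ` set xs = {1..length xs}"
    by (intro card_subset_eq) (auto simp: card_image[OF inj] distinct_card[OF assms])
  then have "map ?rank xs \<in> permutations_of_set {1..length xs}"
    using assms inj by (simp add: permutations_of_set_def distinct_map)
  then show "map ?rank xs \<in> perms"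
    unfolding perms_def by blast
qed

text \<open>Containment is invariant under standardization. This turns the guard of a push into
  avoidance by the container itself, whose entries need not form an initial interval.\<close>

lemma ex_Av_order_iso_iff:
  assumes "distinct c"
  shows "(\<exists>\<sigma>\<in>Av B. order_iso c \<sigma>) \<longleftrightarrow> (\<forall>\<beta>\<in>B. \<not> contains c \<beta>)"
proof
  assume "\<exists>\<sigma>\<in>Av B. order_iso c \<sigma>"
  then show "\<forall>\<beta>\<in>B. \<not> contains c \<beta>"
    unfolding Av_def using contains_order_iso by blast
next
  assume avoid: "\<forall>\<beta>\<in>B. \<not> contains c \<beta>"
  obtain \<sigma> where "\<sigma> \<in> perms" "order_iso c \<sigma>"
    using assms by (rule ex_perm_order_iso)
  then show "\<exists>\<sigma>\<in>Av B. order_iso c \<sigma>"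
    unfolding Av_def using avoid contains_order_iso order_iso_sym by blast
qed

lemma perms_distinct_set:
  assumes "\<pi> \<in> perms"
  shows "distinct \<pi>" "set \<pi> = {1..length \<pi>}"
proof -
  obtain n where n: "set \<pi> = {1..n}" and dist: "distinct \<pi>"
    using assms by (auto simp: perms_def permutations_of_set_def)
  show "distinct \<pi>"
    by (rule dist)
  have "length \<pi> = n"
    using distinct_card[OF dist] by (simp add: n)
  then show "set \<pi> = {1..length \<pi>}"
    by (simp add: n)
qed

section \<open>Copies of 1 \<ominus> \<beta>\<close>

lemma order_iso_one_skew:
  assumes "\<beta> \<in> perms"
  shows "order_iso (m # ys) (one_skew \<beta>) \<longleftrightarrow> order_iso ys \<beta> \<and> (\<forall>y\<in>set ys. y < m)"
proof -
  have le: "\<beta> ! i < Suc (length \<beta>)" "\<not> Suc (length \<beta>) < \<beta> ! i" if "i < length \<beta>" for i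
    using nth_mem[OF that] perms_distinct_set(2)[OF assms] by simp_all
  show ?thesis
    unfolding order_iso_def one_skew_def
    by (auto simp: All_less_Suc2 all_set_conv_all_nth le not_less intro: less_imp_le)
qed

lemma not_contains_Nil_one_skew: "\<not> contains [] (one_skew \<beta>)"
  by (simp add: contains_def order_iso_def one_skew_def)

text \<open>A copy that uses \<open>a\<close> has it as its leading maximum, so the rest of the copy
  lies among the smaller entries after \<open>a\<close>. The recursion thus follows the output one
  entry at a time.\<close>

lemma contains_Cons_one_skew:
  assumes "\<beta> \<in> perms"
  shows "contains (a # w) (one_skew \<beta>) \<longleftrightarrow>
    contains w (one_skew \<beta>) \<or> contains (filter (\<lambda>x. x < a) w) \<beta>"
proof
  assume "contains (a # w) (one_skew \<beta>)"
  then obtain zs where zs: "subseq zs (a # w)" "order_iso zs (one_skew \<beta>)"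
    by (auto simp: contains_def)
  then obtain m ys where mys: "zs = m # ys"
    by (cases zs) (auto simp: order_iso_def one_skew_def)
  show "contains w (one_skew \<beta>) \<or> contains (filter (\<lambda>x. x < a) w) \<beta>"
  proof (cases "m = a")
    case True
    have ys: "order_iso ys \<beta>" "\<forall>y\<in>set ys. y < a"
      using zs(2) order_iso_one_skew[OF assms] by (simp_all add: mys True)
    have "subseq ys w"
      using zs(1) by (simp add: mys True)
    \<comment> \<open>Filtering preserves \<open>subseq\<close>, and it leaves \<open>ys\<close>
      unchanged because all entries of \<open>ys\<close> lie below \<open>a\<close>.\<close>
    then have "subseq (filter (\<lambda>x. x < a) ys) (filter (\<lambda>x. x < a) w)"
      by (rule subseq_filter)
    then show ?thesis
      using ys by (auto simp: contains_def filter_True)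
  next
    case False
    then show ?thesis
      using zs by (auto simp: contains_def mys)
  qed
next
  assume "contains w (one_skew \<beta>) \<or> contains (filter (\<lambda>x. x < a) w) \<beta>"
  then show "contains (a # w) (one_skew \<beta>)"
  proof
    assume "contains w (one_skew \<beta>)"
    then show ?thesis
      by (rule contains_subseq) auto
  next
    assume "contains (filter (\<lambda>x. x < a) w) \<beta>"
    then obtain ys where ys: "subseq ys (filter (\<lambda>x. x < a) w)" "order_iso ys \<beta>"
      by (auto simp: contains_def)
    then have "\<forall>y\<in>set ys. y < a"
      using subseq_set_subset by fastforce
    then have "order_iso (a # ys) (one_skew \<beta>)"
      using ys(2) order_iso_one_skew[OF assms] by simp
    moreover have "subseq (a # ys) (a # w)"
      using subseq_order.order_trans[OF ys(1) subseq_filter_left] by simp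
    ultimately show ?thesis
      by (auto simp: contains_def)
  qed
qed

section \<open>Invariants of machine states\<close>

text \<open>The list \<open>w\<close> is what remains to be output when the machine holds \<open>inp\<close> and \<open>c\<close>.\<close>

definition remaining_output :: "nat list \<Rightarrow> nat list \<Rightarrow> nat list \<Rightarrow> bool" where
  "remaining_output inp c w \<longleftrightarrow>
     distinct w \<and> set w = set c \<union> set inp \<and> filter (\<lambda>x. x \<in> set c) w = c"

text \<open>The trace left by reading the input in increasing order: whatever has reached the
  container was read earlier, hence is smaller than all that is still unread.\<close>

definition ordered_state :: "nat list \<Rightarrow> nat list \<Rightarrow> bool" where
  "ordered_state inp c \<longleftrightarrow>
     distinct c \<and> sorted_wrt (<) inp \<and> (\<forall>x\<in>set c. \<forall>y\<in>set inp. x < y)"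

lemma ordered_state_bypass: "ordered_state (a # inp) c \<Longrightarrow> ordered_state inp c"
  by (auto simp: ordered_state_def)

lemma ordered_state_push:
  "ordered_state (a # inp) (xs @ ys) \<Longrightarrow> ordered_state inp (xs @ a # ys)"
  by (auto simp: ordered_state_def)

lemma ordered_state_pop: "ordered_state inp (a # c) \<Longrightarrow> ordered_state inp c"
  by (auto simp: ordered_state_def)

text \<open>The threshold \<open>a\<close> separates container from input, so among the remaining
  entries being below \<open>a\<close> amounts to lying in the container.\<close>

lemma filter_less_remaining_output:
  assumes "remaining_output inp c w" "\<forall>x\<in>set c. x < a" "\<forall>x\<in>set inp. a \<le> x"
  shows "filter (\<lambda>x. x < a) w = c"
proof -
  have "filter (\<lambda>x. x < a) w = filter (\<lambda>x. x \<in> set c) w"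
    by (rule filter_cong) (use assms in \<open>auto simp: remaining_output_def\<close>)
  then show ?thesis
    using assms(1) by (simp add: remaining_output_def)
qed

section \<open>Every generated permutation avoids 1 \<ominus> B\<close>

text \<open>Induction strips the first step of the run, so \<open>w\<close> is built from its end.
  It grows only at a bypass or a pop, and a new copy would have to start with the entry just
  output.\<close>

lemma generated_output_avoids:
  assumes "B \<subseteq> perms"
    and "(machine_step (Av B))\<^sup>*\<^sup>* (inp, c, out) ([], [], \<pi>)"
    and "ordered_state inp c" "\<forall>\<beta>\<in>B. \<not> contains c \<beta>"
  shows "\<exists>w. \<pi> = out @ w \<and> remaining_output inp c w \<and> (\<forall>\<beta>\<in>B. \<not> contains w (one_skew \<beta>))"
  using assms(2-)
proof (induction "(inp, c, out)" arbitrary: inp c out rule: converse_rtranclp_induct)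
  case base
  then show ?case
    by (simp add: remaining_output_def not_contains_Nil_one_skew)
next
  case (step s)
  from step.hyps(1) show ?case
  proof cases
    case (bypass a inp')
    have ord: "ordered_state (a # inp') c"
      using step.prems(1) bypass by simp
    obtain w where w: "\<pi> = (out @ [a]) @ w" "remaining_output inp' c w"
      "\<forall>\<beta>\<in>B. \<not> contains w (one_skew \<beta>)"
      using step.hyps(3)[OF bypass(2) ordered_state_bypass[OF ord] step.prems(2)] by blast
    have "filter (\<lambda>x. x < a) w = c"
      using w(2) by (rule filter_less_remaining_output) (use ord in \<open>auto simp: ordered_state_def\<close>)
    then have "\<forall>\<beta>\<in>B. \<not> contains (a # w) (one_skew \<beta>)"
      using w(3) step.prems(2) contains_Cons_one_skew[OF subsetD[OF assms(1)]] by simp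
    moreover have "remaining_output inp c (a # w)"
      using w(2) ord bypass(1) by (auto simp: remaining_output_def ordered_state_def)
    ultimately show ?thesis
      using w(1) by auto
  next
    case (push xs a ys inp')
    have ord: "ordered_state inp' (xs @ a # ys)"
      using step.prems(1) push by (auto intro: ordered_state_push)
    then have "\<forall>\<beta>\<in>B. \<not> contains (xs @ a # ys) \<beta>"
      using push(4) ex_Av_order_iso_iff by (simp add: ordered_state_def)
    from step.hyps(3)[OF push(3) ord this]
    obtain w where w: "\<pi> = out @ w" "remaining_output inp' (xs @ a # ys) w"
      "\<forall>\<beta>\<in>B. \<not> contains w (one_skew \<beta>)"
      by blast
    \<comment> \<open>The old container is recovered in two stages: restrict \<open>w\<close> to the
      new container, then delete the pushed entry \<open>a\<close>.\<close>
    have "filter (\<lambda>x. x \<in> set c) w = filter (\<lambda>x. x \<in> set c) (filter (\<lambda>x. x \<in> set (xs @ a # ys)) w)"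
      using push(2) by (auto intro: filter_cong)
    also have "\<dots> = filter (\<lambda>x. x \<in> set c) (xs @ a # ys)"
      using w(2) by (simp add: remaining_output_def)
    also have "\<dots> = c"
      using ord push(2) by (auto simp: ordered_state_def filter_True)
    finally have "remaining_output inp c w"
      using w(2) push(1,2) by (auto simp: remaining_output_def)
    then show ?thesis
      using w(1,3) by blast
  next
    case (pop a c')
    have ord: "ordered_state inp (a # c')"
      using step.prems(1) pop by simp
    have avoid: "\<forall>\<beta>\<in>B. \<not> contains c' \<beta>"
      using step.prems(2) pop(1) contains_subseq[of c' _ "a # c'"] by auto
    obtain w where w: "\<pi> = (out @ [a]) @ w" "remaining_output inp c' w"
      "\<forall>\<beta>\<in>B. \<not> contains w (one_skew \<beta>)"
      using step.hyps(3)[OF pop(2) ordered_state_pop[OF ord] avoid] by blast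
    \<comment> \<open>Unread entries exceed \<open>a\<close>, so the smaller remaining ones all lie
      in \<open>c'\<close>. As \<open>c'\<close> may also hold larger entries, only a subsequence of
      \<open>c'\<close> results.\<close>
    have filt: "filter (\<lambda>x. x \<in> set c' \<and> x < a) w = filter (\<lambda>x. x < a) w"
      by (rule filter_cong) (use w(2) ord in \<open>auto simp: remaining_output_def ordered_state_def\<close>)
    have "filter (\<lambda>x. x < a) w = filter (\<lambda>x. x < a) (filter (\<lambda>x. x \<in> set c') w)"
      using filt by (simp add: conj_commute)
    also have "\<dots> = filter (\<lambda>x. x < a) c'"
      using w(2) by (simp add: remaining_output_def)
    finally have "subseq (filter (\<lambda>x. x < a) w) c'"
      by simp
    then have "\<forall>\<beta>\<in>B. \<not> contains (a # w) (one_skew \<beta>)"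
      using w(3) avoid contains_subseq contains_Cons_one_skew[OF subsetD[OF assms(1)]] by blast
    moreover have notin: "a \<notin> set w"
      using w(2) ord by (auto simp: remaining_output_def ordered_state_def)
    have "filter (\<lambda>x. x \<in> set c) w = filter (\<lambda>x. x \<in> set c') w"
      by (rule filter_cong) (use notin pop(1) in auto)
    then have "remaining_output inp c (a # w)"
      using w(2) pop(1) notin by (auto simp: remaining_output_def)
    ultimately show ?thesis
      using w(1) by auto
  qed
qed

section \<open>Greedy generation of every avoider of 1 \<ominus> B\<close>

text \<open>The sum of the two lengths serves as measure because a push shortens only
  \<open>inp\<close> and a pop only \<open>w\<close>.\<close>

lemma avoider_generated:
  assumes "B \<subseteq> perms"
    and "ordered_state inp c" "remaining_output inp c w" "\<forall>\<beta>\<in>B. \<not> contains w (one_skew \<beta>)"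
  shows "(machine_step (Av B))\<^sup>*\<^sup>* (inp, c, out) ([], [], out @ w)"
  using assms(2-)
proof (induction "length w + length inp" arbitrary: inp c out w rule: less_induct)
  case less
  note ord = less.prems(1) and rem = less.prems(2) and avoid = less.prems(3)
  show ?case
  proof (cases w)
    case Nil
    then show ?thesis
      using rem by (simp add: remaining_output_def)
  next
    case (Cons a w')
    have avoid': "\<forall>\<beta>\<in>B. \<not> contains w' (one_skew \<beta>)"
      and small: "\<forall>\<beta>\<in>B. \<not> contains (filter (\<lambda>x. x < a) w') \<beta>"
      using avoid contains_Cons_one_skew[OF subsetD[OF assms(1)]] by (auto simp: Cons)
    show ?thesis
    proof (cases "a \<in> set c")
      case True
      \<comment> \<open>The container is in output order, so the next output entry, if present
        there, is leftmost and can be popped.\<close>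
      then obtain c' where c: "c = a # c'"
        using rem by (metis Cons filter.simps(2) remaining_output_def)
      have "a \<notin> set w'"
        using rem by (simp add: remaining_output_def Cons)
      then have "filter (\<lambda>x. x \<in> set c) w' = filter (\<lambda>x. x \<in> set c') w'"
        by (intro filter_cong) (auto simp: c)
      then have "remaining_output inp c' w'"
        using rem ord by (auto simp: remaining_output_def ordered_state_def Cons c)
      then have "(machine_step (Av B))\<^sup>*\<^sup>* (inp, c', out @ [a]) ([], [], (out @ [a]) @ w')"
        using ordered_state_pop[OF ord[unfolded c]] avoid' by (intro less.hyps) (simp_all add: Cons)
      then show ?thesis
        using converse_rtranclp_into_rtranclp[of "machine_step (Av B)", OF machine_step.pop]
        by (fastforce simp: Cons c)
    next
      case False
      then have "a \<in> set inp"
        using rem by (auto simp: remaining_output_def Cons)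
      then obtain b inp' where inp: "inp = b # inp'"
        by (cases inp) auto
      show ?thesis
      proof (cases "a = b")
        case True
        have "remaining_output inp' c w'"
          using rem ord False by (auto simp: remaining_output_def ordered_state_def Cons inp True)
        then have "(machine_step (Av B))\<^sup>*\<^sup>* (inp', c, out @ [a]) ([], [], (out @ [a]) @ w')"
          using ordered_state_bypass[OF ord[unfolded inp]] avoid'
          by (intro less.hyps) (simp_all add: Cons inp)
        then show ?thesis
          using converse_rtranclp_into_rtranclp[of "machine_step (Av B)", OF machine_step.bypass]
          by (fastforce simp: Cons inp True)
      next
        case neq: False
        then have "b < a"
          using \<open>a \<in> set inp\<close> ord by (auto simp: ordered_state_def inp)
        have "b \<in> set w'"
          using rem neq by (auto simp: remaining_output_def Cons inp)
        then obtain w1 w2 where w': "w' = w1 @ b # w2"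
          by (auto simp: in_set_conv_decomp)
        \<comment> \<open>The insertion point is forced: \<open>b\<close> goes between the container
          entries that precede it in the desired output and those that follow it.\<close>
        define xs ys where "xs = filter (\<lambda>x. x \<in> set c) w1" and "ys = filter (\<lambda>x. x \<in> set c) w2"
        have "b \<notin> set c"
          using ord by (auto simp: ordered_state_def inp)
        then have c: "c = xs @ ys"
          using rem False by (simp add: remaining_output_def Cons w' xs_def ys_def)
        have ord': "ordered_state inp' (xs @ b # ys)"
          using ord by (auto simp: inp c intro: ordered_state_push)
        have "b \<notin> set w1" "b \<notin> set w2"
          using rem by (auto simp: remaining_output_def Cons w')
        then have "filter (\<lambda>x. x \<in> set (xs @ b # ys)) w1 = filter (\<lambda>x. x \<in> set c) w1"
          "filter (\<lambda>x. x \<in> set (xs @ b # ys)) w2 = filter (\<lambda>x. x \<in> set c) w2"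
          by (auto simp: c intro!: filter_cong)
        then have "filter (\<lambda>x. x \<in> set (xs @ b # ys)) w1 = xs"
          "filter (\<lambda>x. x \<in> set (xs @ b # ys)) w2 = ys"
          by (simp_all only: xs_def ys_def)
        then have rem': "remaining_output inp' (xs @ b # ys) w"
          using rem False neq by (auto simp: remaining_output_def Cons inp c w')
        have "filter (\<lambda>x. x \<in> set (xs @ b # ys)) w' = xs @ b # ys"
          using rem' False neq by (simp add: remaining_output_def Cons c)
        \<comment> \<open>Since \<open>a\<close> is still unread, it exceeds the whole container,
          and it exceeds \<open>b\<close> because the input increases. So the new container sits
          inside the part of \<open>w'\<close> below \<open>a\<close>, where \<open>small\<close>
          excludes every \<beta>.\<close>
        moreover have "\<forall>x \<in> set (xs @ b # ys). x < a"
          using ord \<open>b < a\<close> \<open>a \<in> set inp\<close> by (auto simp: ordered_state_def c)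
        ultimately have "subseq (xs @ b # ys) (filter (\<lambda>x. x < a) w')"
          by (metis (no_types, lifting) filter_True subseq_filter subseq_filter_left)
        then have "\<forall>\<beta>\<in>B. \<not> contains (xs @ b # ys) \<beta>"
          using small contains_subseq by blast
        then have "\<exists>\<sigma>\<in>Av B. order_iso (xs @ b # ys) \<sigma>"
          using ord' by (simp add: ex_Av_order_iso_iff ordered_state_def)
        then have "machine_step (Av B) (inp, c, out) (inp', xs @ b # ys, out)"
          unfolding inp c by (rule machine_step.push)
        moreover have "(machine_step (Av B))\<^sup>*\<^sup>* (inp', xs @ b # ys, out) ([], [], out @ w)"
          using ord' rem' avoid by (intro less.hyps) (simp_all add: inp)
        ultimately show ?thesis
          by (rule converse_rtranclp_into_rtranclp)
      qed
    qed
  qed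
qed

theorem theorem1p1:
  fixes B :: "nat list set"
  assumes "B \<subseteq> perms" and "[] \<notin> B"
  shows "generated (Av B) = Av (one_skew ` B) \<and> perm_class (Av (one_skew ` B))"
proof
  have ord: "ordered_state [1..<Suc n] []" for n
    by (simp add: ordered_state_def del: upt_Suc)
  \<comment> \<open>The empty container must avoid \<open>B\<close> at the start. With
    \<open>[]\<close> in \<open>B\<close> the class would be empty, yet bypassing would still
    generate \<open>[1]\<close>, which is \<open>one_skew []\<close>.\<close>
  have Nil: "\<forall>\<beta>\<in>B. \<not> contains [] \<beta>"
    using assms(2) by (auto simp: contains_def order_iso_def dest!: list_emb_Nil2)
  have rem: "remaining_output [1..<Suc (length \<pi>)] [] \<pi>" if "\<pi> \<in> perms" for \<pi>
    using perms_distinct_set[OF that]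
    by (simp add: remaining_output_def atLeastLessThanSuc_atLeastAtMost del: upt_Suc)
  show "generated (Av B) = Av (one_skew ` B)"
  proof (intro set_eqI iffI)
    fix \<pi> assume "\<pi> \<in> generated (Av B)"
    then have "\<pi> \<in> perms"
      and "(machine_step (Av B))\<^sup>*\<^sup>* ([1..<Suc (length \<pi>)], [], []) ([], [], \<pi>)"
      by (simp_all only: generated_def mem_Collect_eq)
    with generated_output_avoids[OF assms(1) this(2) ord Nil] show "\<pi> \<in> Av (one_skew ` B)"
      by (simp add: Av_def)
  next
    fix \<pi> assume "\<pi> \<in> Av (one_skew ` B)"
    then have "\<pi> \<in> perms" and "\<forall>\<beta>\<in>B. \<not> contains \<pi> (one_skew \<beta>)"
      by (simp_all add: Av_def)
    with avoider_generated[OF assms(1) ord rem[OF this(1)] this(2), of "[]"]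
    show "\<pi> \<in> generated (Av B)"
      by (simp add: generated_def del: upt_Suc)
  qed
  show "perm_class (Av (one_skew ` B))"
    by (rule perm_class_Av)
qed

end
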